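(* Let $X$ be a $\sigma$-compact locally compact Hausdorff space, and let $A$ be a closed subset of $X$. If $f\colon A\to [0,\infty)$ is a continuous proper function, then there exists a continuous proper function $F\colon X\to [0,\infty)$ such that $F|_{A}=f$.
   Context: A topological space is $\sigma$-compact if it is a countable union of compact subspaces; it is locally compact if every point has a compact neighborhood. A map $f\colon X\to Y$ between topological spaces is proper if for every compact subset $K$ of $Y$ the inverse image $f^{-1}(K)$ is compact. *)

theory Defs
  imports "HOL-Analysis.Analysis"
begin

definition sigma_compact_space :: "'a topology \<Rightarrow> bool" where
  "sigma_compact_space X \<longleftrightarrow>
     (\<exists>\<C>. countable \<C> \<and> (\<forall>K\<in>\<C>. compactin X K) \<and> \<Union>\<C> = topspace X)"

text \<open>
  Preimages of compact sets are compact. This is not the library's \<open>proper_map\<close>, which is a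
  closed map with compact fibres. Continuity is not part of the definition, but \<open>f\<close> is required
  to map the one carrier into the other.
\<close>

definition compact_proper_map :: "'a topology \<Rightarrow> 'b topology \<Rightarrow> ('a \<Rightarrow> 'b) \<Rightarrow> bool" where
  "compact_proper_map X Y f \<longleftrightarrow>
     f \<in> topspace X \<rightarrow> topspace Y \<and>
     (\<forall>K. compactin Y K \<longrightarrow> compactin X {x \<in> topspace X. f x \<in> K})"

end

theory Submission
  imports Defs
begin

text \<open>
  The sublevel sets \<open>{x \<in> A. f x \<le> n + 1}\<close> are compact, so \<open>X\<close> has an exhaustion by compact sets
  \<open>L n\<close>, each inside the interior of the next, with \<open>{x \<in> A. f x \<le> n + 1} \<subseteq> L n\<close>. Adding up
  Urysohn functions that climb from 0 on \<open>L n\<close> to 1 outside \<open>L (n + 1)\<close> gives a continuous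
  function \<open>w\<close> with \<open>w \<ge> n\<close> outside \<open>L n\<close> and \<open>w \<le> f\<close> on \<open>A\<close>. If \<open>g\<close> is a Tietze extension
  of \<open>f\<close>, then \<open>max g w\<close> extends \<open>f\<close>, and it is proper because \<open>w\<close> is.
\<close>

lemma sigma_compact_space_sequence:
  assumes "sigma_compact_space X"
  obtains C :: "nat \<Rightarrow> 'a set" where "\<And>n. compactin X (C n)" "(\<Union>n. C n) = topspace X"
proof -
  obtain \<C> where \<C>: "countable \<C>" "\<And>K. K \<in> \<C> \<Longrightarrow> compactin X K" "\<Union>\<C> = topspace X"
    using assms unfolding sigma_compact_space_def by metis
  \<comment> \<open>Inserting \<open>{}\<close> keeps the family nonempty, so
    \<open>from_nat_into\<close> enumerates exactly this family even when \<open>\<C>\<close> is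
    empty.\<close>
  have "range (from_nat_into (insert {} \<C>)) = insert {} \<C>"
    using \<C>(1) by (intro range_from_nat_into) auto
  moreover have "compactin X (from_nat_into (insert {} \<C>) n)" for n
    using from_nat_into [of "insert {} \<C>" n] \<C>(2) by auto
  ultimately show thesis
    using that [of "from_nat_into (insert {} \<C>)"] \<C>(3) by simp
qed

text \<open>Combined with regularity, which a locally compact Hausdorff space has, this yields the
  normality that Urysohn and Tietze require.\<close>

lemma sigma_compact_imp_Lindelof_space:
  assumes "sigma_compact_space X"
  shows "Lindelof_space X"
proof -
  obtain C :: "nat \<Rightarrow> 'a set" where C: "\<And>n. compactin X (C n)" "(\<Union>n. C n) = topspace X"
    using sigma_compact_space_sequence [OF assms] by blast
  have "Lindelof_space (subtopology X (\<Union>(range C)))"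
    by (rule Lindelof_space_Union) (auto simp: C(1) compact_imp_Lindelof_space compact_space_subtopology)
  then show ?thesis
    by (simp add: C(2))
qed

text \<open>Local compactness puts every compact set into the interior of another one. Enlarging in
  this way the union of the previous stage, the next \<open>K n\<close> and the next piece of a
  countable compact cover gives \<open>L\<close>.\<close>

lemma compact_exhaustion_absorbing:
  fixes K :: "nat \<Rightarrow> 'a set"
  assumes "sigma_compact_space X" "locally_compact_space X" "Hausdorff_space X"
    and K: "\<And>n. compactin X (K n)"
  obtains L :: "nat \<Rightarrow> 'a set"
  where "\<And>n. compactin X (L n)" "\<And>n. K n \<subseteq> L n" "\<And>n. L n \<subseteq> X interior_of L (Suc n)"
    "(\<Union>n. L n) = topspace X"
proof -
  obtain C :: "nat \<Rightarrow> 'a set" where C: "\<And>n. compactin X (C n)" "(\<Union>n. C n) = topspace X"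
    using sigma_compact_space_sequence [OF assms(1)] by blast
  have "\<forall>S. \<exists>T. compactin X S \<longrightarrow> compactin X T \<and> S \<subseteq> X interior_of T"
    using assms locally_compact_space_compact_closed_compact [of X]
    by (metis interior_of_maximal subset_trans)
  then obtain E where E: "\<And>S. compactin X S \<Longrightarrow> compactin X (E S) \<and> S \<subseteq> X interior_of E S"
    by metis
  define L where "L \<equiv> rec_nat (K 0 \<union> C 0) (\<lambda>n S. E (S \<union> K (Suc n) \<union> C (Suc n)))"
  have L_0: "L 0 = K 0 \<union> C 0" and L_Suc: "L (Suc n) = E (L n \<union> K (Suc n) \<union> C (Suc n))" for n
    by (simp_all add: L_def)
  have comp: "compactin X (L n)" for n
    by (induction n) (simp_all add: L_0 L_Suc E compactin_Un K C)
  then have step: "L n \<union> K (Suc n) \<union> C (Suc n) \<subseteq> X interior_of L (Suc n)" for n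
    using E [of "L n \<union> K (Suc n) \<union> C (Suc n)"] by (simp add: L_Suc compactin_Un K C)
  have KC: "K n \<union> C n \<subseteq> L n" for n
    using step interior_of_subset by (cases n) (fastforce simp: L_0)+
  show thesis
  proof
    show "(\<Union>n. L n) = topspace X"
    proof
      show "(\<Union>n. L n) \<subseteq> topspace X"
        using comp compactin_subset_topspace by (intro UN_least) auto
      show "topspace X \<subseteq> (\<Union>n. L n)"
        unfolding C(2) [symmetric] using KC by (intro UN_mono) auto
    qed
    show "K n \<subseteq> L n" "L n \<subseteq> X interior_of L (Suc n)" for n
      using KC [of n] step [of n] by simp_all
  qed (rule comp)
qed

text \<open>Let \<open>u i\<close> climb from 0 on \<open>L i\<close> to 1 off
  \<open>L (Suc i)\<close>, and sum over \<open>i\<close>. Off \<open>L n\<close> the first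
  \<open>n\<close> terms all equal 1; on \<open>L n\<close> only these terms can be nonzero, and
  each is at most 1.\<close>

lemma exhaustion_imp_proper_function:
  fixes L :: "nat \<Rightarrow> 'a set"
  assumes "normal_space X"
    and clo: "\<And>n. closedin X (L n)"
    and int: "\<And>n. L n \<subseteq> X interior_of L (Suc n)"
    and cover: "(\<Union>n. L n) = topspace X"
  obtains w :: "'a \<Rightarrow> real"
  where "continuous_map X euclideanreal w"
    "\<And>x n. x \<in> topspace X - L n \<Longrightarrow> real n \<le> w x"
    "\<And>x n. x \<in> L n \<Longrightarrow> w x \<le> real n"
proof -
  \<comment> \<open>Urysohn needs two disjoint closed sets, hence the complement of the interior of
    \<open>L (Suc n)\<close> and not of \<open>L (Suc n)\<close> itself.\<close>
  have "\<exists>v. continuous_map X (top_of_set {0..1::real}) v \<and> v ` L n \<subseteq> {0} \<and>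
            v ` (topspace X - X interior_of L (Suc n)) \<subseteq> {1}" for n
    using Urysohn_lemma [OF \<open>normal_space X\<close> clo [of n], of "topspace X - X interior_of L (Suc n)" 0 1]
      int [of n] by (metis Diff_disjoint closedin_diff closedin_topspace disjnt_def disjnt_subset1 openin_interior_of zero_le_one)
  then obtain u where u: "\<And>n. continuous_map X (top_of_set {0..1::real}) (u n)"
    and "\<And>n. u n ` L n \<subseteq> {0}"
    and "\<And>n. u n ` (topspace X - X interior_of L (Suc n)) \<subseteq> {1}"
    by metis
  then have u0: "\<And>n x. x \<in> L n \<Longrightarrow> u n x = 0"
    and u1: "\<And>n x. x \<in> topspace X - L (Suc n) \<Longrightarrow> u n x = 1"
    using interior_of_subset by fastforce+
  have cont: "\<And>n. continuous_map X euclideanreal (u n)"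
    and u01: "\<And>n x. x \<in> topspace X \<Longrightarrow> u n x \<in> {0..1}"
    using u by (fastforce simp: continuous_map_in_subtopology)+
  have mono: "L m \<subseteq> L n" if "m \<le> n" for m n
    using lift_Suc_mono_le [of L, OF order_trans [OF int interior_of_subset] that] .
  define w where "w x \<equiv> \<Sum>i. u i x" for x
  have w_eq: "w x = (\<Sum>i<n. u i x)" if "x \<in> L n" for x n
  proof -
    have "u i x = 0" if "i \<notin> {..<n}" for i
      using mono [of n i] that \<open>x \<in> L n\<close> by (intro u0) auto
    then show ?thesis
      unfolding w_def by (intro suminf_finite) auto
  qed
  show thesis
  proof
    \<comment> \<open>The interiors of the \<open>L n\<close> form an open cover, and on each of
      them \<open>w\<close> is a finite sum of continuous functions.\<close>
    show "continuous_map X euclideanreal w"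
    proof (rule pasting_lemma [where I = UNIV and T = "\<lambda>n. X interior_of L n"
                                 and f = "\<lambda>n x. \<Sum>i<n. u i x"])
      show "continuous_map (subtopology X (X interior_of L n)) euclideanreal (\<lambda>x. \<Sum>i<n. u i x)" for n
        by (intro continuous_map_from_subtopology continuous_map_sum cont) auto
      show "(\<Sum>i<m. u i x) = (\<Sum>i<n. u i x)"
        if "x \<in> topspace X \<inter> X interior_of L m \<inter> X interior_of L n" for m n x
        using that w_eq interior_of_subset by (metis IntE subsetD)
      show "\<exists>n. n \<in> UNIV \<and> x \<in> X interior_of L n \<and> w x = (\<Sum>i<n. u i x)"
        if "x \<in> topspace X" for x
        using that cover int w_eq interior_of_subset by (metis UNIV_I UN_E subsetD)
    qed auto
    show "real n \<le> w x" if x: "x \<in> topspace X - L n" for x n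
    proof -
      \<comment> \<open>Some \<open>L k\<close> contains \<open>x\<close>, so \<open>w x\<close> is
        a finite sum; it includes the first \<open>n\<close> terms because \<open>x\<close> lies
        outside \<open>L n\<close>.\<close>
      obtain k where k: "x \<in> L k"
        using x cover by blast
      have "n \<le> k"
        using k x mono by (meson DiffE nle_le subsetD)
      have "u i x = 1" if "i < n" for i
        using that x mono [of "Suc i" n] by (intro u1) auto
      then have "real n = (\<Sum>i<n. u i x)"
        by simp
      also have "\<dots> \<le> (\<Sum>i<k. u i x)"
        using \<open>n \<le> k\<close> u01 x by (intro sum_mono2) auto
      finally show ?thesis
        using w_eq k by simp
    qed
    show "w x \<le> real n" if "x \<in> L n" for x n
    proof -
      have "(\<Sum>i<n. u i x) \<le> (\<Sum>i<n. 1)"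
        using that cover u01 by (intro sum_mono) auto
      then show ?thesis
        using w_eq [OF that] by simp
    qed
  qed
qed

theorem theorem2p3:
  fixes X :: "'a topology" and A :: "'a set" and f :: "'a \<Rightarrow> real"
  assumes "sigma_compact_space X"
    and "locally_compact_space X"
    and "Hausdorff_space X"
    and "closedin X A"
    and "continuous_map (subtopology X A) (top_of_set {0..}) f"
    and "compact_proper_map (subtopology X A) (top_of_set {0..}) f"
  shows "\<exists>F :: 'a \<Rightarrow> real.
           continuous_map X (top_of_set {0..}) F \<and>
           compact_proper_map X (top_of_set {0..}) F \<and>
           (\<forall>x\<in>A. F x = f x)"
proof -
  have AX: "A \<subseteq> topspace X"
    using assms(4) closedin_subset by blast
  have contf: "continuous_map (subtopology X A) euclideanreal f" and f0: "\<And>x. x \<in> A \<Longrightarrow> 0 \<le> f x"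
    using assms(5) AX by (fastforce simp: continuous_map_in_subtopology)+
  have "normal_space X"
    using assms locally_compact_Hausdorff_imp_regular_space sigma_compact_imp_Lindelof_space
      regular_Lindelof_imp_normal_space by blast
  have sublevel: "compactin X {x \<in> A. f x \<le> c}" for c
  proof -
    \<comment> \<open>As \<open>f\<close> is nonnegative on \<open>A\<close>, its sublevel set is
      the preimage of this interval, which is empty if \<open>c\<close> is negative.\<close>
    have "compactin (top_of_set {0..}) {0..c}"
      by (auto simp: compactin_subtopology)
    then have "compactin (subtopology X A) {x \<in> topspace (subtopology X A). f x \<in> {0..c}}"
      using assms(6) unfolding compact_proper_map_def by blast
    moreover have "{x \<in> topspace (subtopology X A). f x \<in> {0..c}} = {x \<in> A. f x \<le> c}"
      using AX f0 by auto
    ultimately show ?thesis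
      by (simp add: compactin_subtopology)
  qed
  obtain L :: "nat \<Rightarrow> 'a set"
    where comp: "\<And>n. compactin X (L n)" and AL: "\<And>n. {x \<in> A. f x \<le> real (Suc n)} \<subseteq> L n"
      and int: "\<And>n. L n \<subseteq> X interior_of L (Suc n)" and cover: "(\<Union>n. L n) = topspace X"
    using compact_exhaustion_absorbing
      [OF assms(1-3), where K = "\<lambda>n. {x \<in> A. f x \<le> real (Suc n)}", OF sublevel] by blast
  have clo: "closedin X (L n)" for n
    using comp assms(3) compactin_imp_closedin by blast
  obtain w :: "'a \<Rightarrow> real" where contw: "continuous_map X euclideanreal w"
    and w_ge: "\<And>x n. x \<in> topspace X - L n \<Longrightarrow> real n \<le> w x"
    and w_le: "\<And>x n. x \<in> L n \<Longrightarrow> w x \<le> real n"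
    using exhaustion_imp_proper_function [OF \<open>normal_space X\<close> clo int cover] by blast
  \<comment> \<open>Take the first \<open>n\<close> with \<open>x \<in> L n\<close>, so that
    \<open>w x \<le> n\<close>. If \<open>n = Suc k\<close>, then \<open>x\<close> is not in
    \<open>L k\<close>, which absorbed the sublevel set at \<open>Suc k\<close>, so
    \<open>f x > n\<close>. This is why the levels are shifted by one. If \<open>n = 0\<close>,
    nonnegativity of \<open>f\<close> suffices.\<close>
  have wf: "w x \<le> f x" if "x \<in> A" for x
  proof -
    define n where "n = (LEAST n. x \<in> L n)"
    have "\<exists>n. x \<in> L n"
      using that AX cover by blast
    then have "x \<in> L n"
      unfolding n_def by (rule LeastI_ex)
    then have "w x \<le> real n"
      by (rule w_le)
    also have "real n \<le> f x"
    proof (cases n)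
      case (Suc k)
      then have "x \<notin> L k"
        unfolding n_def by (metis lessI not_less_Least)
      then show ?thesis
        using AL [of k] that Suc by force
    qed (simp add: f0 that)
    finally show ?thesis .
  qed
  obtain g where contg: "continuous_map X euclideanreal g" and "g ` topspace X \<subseteq> {0..}"
    and gf: "\<And>x. x \<in> A \<Longrightarrow> g x = f x"
    using Tietze_extension_realinterval [OF \<open>normal_space X\<close> assms(4) _ _ contf, of "{0..}"] f0
    by (auto simp: is_interval_ci)
  define F where "F x \<equiv> max (g x) (w x)" for x
  have F0: "F \<in> topspace X \<rightarrow> {0..}"
    using \<open>g ` topspace X \<subseteq> {0..}\<close> by (force simp: F_def)
  have contF: "continuous_map X euclideanreal F"
    unfolding F_def by (intro continuous_map_real_max contg contw)
  \<comment> \<open>If \<open>n\<close> bounds \<open>K\<close> strictly from above,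
    \<open>F x \<in> K\<close> forces \<open>w x < n\<close> and hence \<open>x \<in> L n\<close>.
    The preimage is thus a closed subset of a compact set.\<close>
  have "compactin X {x \<in> topspace X. F x \<in> K}" if K: "compactin (top_of_set {0..}) K" for K
  proof -
    have "compact K"
      using K by (simp add: compactin_subtopology)
    then obtain n where n: "\<And>y. y \<in> K \<Longrightarrow> y < real n"
      by (metis bounded_has_Sup(1) compact_imp_bounded empty_iff le_less_trans reals_Archimedean2)
    have "closedin X {x \<in> topspace X. F x \<in> K}"
      using contF \<open>compact K\<close> by (intro closedin_continuous_map_preimage) (auto simp: compact_imp_closed)
    moreover have "{x \<in> topspace X. F x \<in> K} \<subseteq> L n"
      using n w_ge by (force simp: F_def)
    ultimately show ?thesis
      using comp closed_compactin by blast
  qed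
  then have "compact_proper_map X (top_of_set {0..}) F"
    using F0 by (simp add: compact_proper_map_def)
  moreover have "continuous_map X (top_of_set {0..}) F"
    using contF F0 by (auto simp: continuous_map_in_subtopology)
  moreover have "\<forall>x\<in>A. F x = f x"
    using gf wf by (simp add: F_def)
  ultimately show ?thesis
    by blast
qed

end
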